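(* Suppose $M$ is the incidence matrix of a symmetric $(v,k,\lambda)$-BIBD where $k$ is odd and $\lambda$ is even. Then \[R_2(M)=\frac{k^2-\lambda^2}{\binom{v}{2}}.\]
   Context: A $(v,k,\lambda)$-balanced incomplete block design (BIBD), with $v\ge k\ge 2$, is a pair $(X,\mathcal{A})$ where $X$ is a set of $v$ points and $\mathcal{A}$ is a collection of $k$-subsets of $X$ (blocks) such that every pair of distinct points occurs in exactly $\lambda$ blocks. It is symmetric if the number $b=|\mathcal{A}|$ of blocks equals $v$ (equivalently, every point lies in exactly $k$ blocks, equivalently $\lambda(v-1)=k(k-1)$). With $X=\{x_1,\dots,x_v\}$ and $\mathcal{A}=\{A_1,\dots,A_b\}$, the incidence matrix is the $v\times b$ $0$-$1$ matrix $M=(m_{ij})$ with $m_{ij}=1$ iff $x_i\in A_j$. For an $s\times s$ $0$-$1$ matrix $M$, $R_2(M)=N_2(M)/\binom{s}{2}^2$, where $N_2(M)$ is the number of $2\times 2$ submatrices of $M$ (one for each choice of two rows and two columns) that are invertible over $\mathbb{F}_2$. *)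

theory Defs
  imports Complex_Main "HOL-Library.Multiset" "HOL-Library.Z2" "Jordan_Normal_Form.DL_Submatrix"
begin

text \<open>The blocks form a multiset, so a ``collection'' of blocks may contain repetitions.\<close>

definition bibd :: "'a set \<Rightarrow> 'a set multiset \<Rightarrow> nat \<Rightarrow> nat \<Rightarrow> nat \<Rightarrow> bool" where
  "bibd X \<A> v k l \<longleftrightarrow>
     2 \<le> k \<and> k \<le> v \<and> finite X \<and> card X = v \<and>
     (\<forall>A\<in>#\<A>. A \<subseteq> X \<and> card A = k) \<and>
     (\<forall>x\<in>X. \<forall>y\<in>X. x \<noteq> y \<longrightarrow> size {#A \<in># \<A>. x \<in> A \<and> y \<in> A#} = l)"

definition symmetric_bibd :: "'a set \<Rightarrow> 'a set multiset \<Rightarrow> nat \<Rightarrow> nat \<Rightarrow> nat \<Rightarrow> bool" where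
  "symmetric_bibd X \<A> v k l \<longleftrightarrow> bibd X \<A> v k l \<and> size \<A> = v"

text \<open>The incidence matrix depends on the chosen enumerations of points and blocks;
  the predicate holds for the matrix of any such choice.\<close>

definition is_incidence_matrix :: "int mat \<Rightarrow> 'a set \<Rightarrow> 'a set multiset \<Rightarrow> bool" where
  "is_incidence_matrix M X \<A> \<longleftrightarrow>
     (\<exists>xs As. distinct xs \<and> set xs = X \<and> mset As = \<A> \<and>
        M = mat (length xs) (length As) (\<lambda>(i, j). if xs ! i \<in> As ! j then 1 else 0))"

text \<open>The type \<open>bit\<close> is the field with two elements.\<close>

definition N2 :: "int mat \<Rightarrow> nat" where
  "N2 M = card {(I, J). I \<subseteq> {..<dim_row M} \<and> J \<subseteq> {..<dim_col M} \<and> card I = 2 \<and> card J = 2 \<and>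
     invertible_mat (map_mat (of_int :: int \<Rightarrow> bit) (submatrix M I J))}"

text \<open>Intended for square matrices only, with \<open>dim_row M\<close> as their size.\<close>

definition R2 :: "int mat \<Rightarrow> real" where
  "R2 M = real (N2 M) / (real (dim_row M choose 2))\<^sup>2"

end

theory Submission
  imports Defs "Jordan_Normal_Form.Determinant"
begin

text \<open>
  Restricted to two rows, the columns of the incidence matrix are vectors over the field with
  two elements: \<open>(1,1)\<close> occurs \<open>l\<close> times, and \<open>(1,0)\<close> and \<open>(0,1)\<close> occur \<open>k - l\<close> times each, since
  symmetry forces every point to lie in \<open>k\<close> blocks. Two columns form an invertible matrix iff
  they are distinct and nonzero, so each pair of rows contributes
  \<open>2 l (k - l) + (k - l)\<^sup>2 = k\<^sup>2 - l\<^sup>2\<close> submatrices.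
\<close>

text \<open>Double counting of incidences between points and blocks. Induction on the multiset lets
  repeated blocks count with multiplicity.\<close>

lemma sum_size_filter_mem:
  assumes "finite X"
  shows "(\<Sum>x\<in>X. size {#A \<in># \<A>. x \<in> A#}) = (\<Sum>A\<in>#\<A>. card (A \<inter> X))"
proof (induction \<A>)
  case (add A \<A>)
  have "(\<Sum>x\<in>X. size {#B \<in># add_mset A \<A>. x \<in> B#})
      = (\<Sum>x\<in>X. of_bool (x \<in> A) + size {#B \<in># \<A>. x \<in> B#})"
    by (intro sum.cong) auto
  also have "\<dots> = card (A \<inter> X) + (\<Sum>x\<in>X. size {#B \<in># \<A>. x \<in> B#})"
    using assms by (simp add: sum.distrib Int_commute Int_def conj_commute)
  finally show ?case using add.IH by simp
qed simp

text \<open>Counting pairs of a block through \<open>y\<close> and a further point of it gives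
  \<open>r y * (k - 1) = l * (v - 1)\<close>, so all points lie in equally many blocks. Counting all
  incidences, with as many blocks as points, makes this common number \<open>k\<close>.\<close>

lemma symmetric_bibd_replication:
  assumes "symmetric_bibd X \<A> v k l" and "x \<in> X"
  shows "size {#A \<in># \<A>. x \<in> A#} = k"
proof -
  from assms(1) have k: "2 \<le> k" "k \<le> v" and X: "finite X" "card X = v" and v: "size \<A> = v"
    by (auto simp: symmetric_bibd_def bibd_def)
  have blocks: "A \<subseteq> X" "card A = k" if "A \<in># \<A>" for A
    using assms(1) that by (auto simp: symmetric_bibd_def bibd_def)
  have pairs: "size {#A \<in># \<A>. y \<in> A \<and> z \<in> A#} = l" if "y \<in> X" "z \<in> X" "y \<noteq> z" for y z
    using assms(1) that by (auto simp: symmetric_bibd_def bibd_def)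
  define r where "r = (\<lambda>y. size {#A \<in># \<A>. y \<in> A#})"
  have point: "r y * (k - 1) = l * (v - 1)" if y: "y \<in> X" for y
  proof -
    have "r y * (k - 1) = (\<Sum>A\<in>#{#A \<in># \<A>. y \<in> A#}. k - 1)"
      by (simp add: r_def)
    also have "\<dots> = (\<Sum>A\<in>#{#A \<in># \<A>. y \<in> A#}. card (A \<inter> (X - {y})))"
    proof (intro arg_cong[where f = sum_mset] image_mset_cong)
      fix A assume "A \<in># {#A \<in># \<A>. y \<in> A#}"
      then have "A \<inter> (X - {y}) = A - {y}" "y \<in> A" "card A = k" "finite A"
        using blocks finite_subset[OF _ X(1)] by auto
      then show "k - 1 = card (A \<inter> (X - {y}))" by simp
    qed
    also have "\<dots> = (\<Sum>z\<in>X - {y}. size {#A \<in># {#A \<in># \<A>. y \<in> A#}. z \<in> A#})"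
      using X by (simp add: sum_size_filter_mem)
    also have "\<dots> = (\<Sum>z\<in>X - {y}. l)"
      using pairs[OF y] by (intro sum.cong) (auto simp: filter_filter_mset conj_commute)
    finally show ?thesis using X y by simp
  qed
  have "(\<Sum>y\<in>X. r y) = (\<Sum>A\<in>#\<A>. k)"
    unfolding r_def sum_size_filter_mem[OF X(1)]
    using blocks by (intro arg_cong[where f = sum_mset] image_mset_cong) (simp add: Int_absorb2)
  then have "v * k * (k - 1) = (\<Sum>y\<in>X. r y * (k - 1))"
    using v by (simp flip: sum_distrib_right)
  also have "\<dots> = v * (r x * (k - 1))"
    using X point assms(2) by simp
  \<comment> \<open>The factors \<open>v\<close> and \<open>k - 1\<close> cancel because
    \<open>k \<ge> 2\<close> and \<open>v \<ge> k\<close>.\<close>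
  finally show ?thesis
    using k by (simp add: r_def)
qed

lemma invertible_mat_iff_det:
  fixes A :: "'a :: field mat"
  assumes A: "A \<in> carrier_mat n n"
  shows "invertible_mat A \<longleftrightarrow> det A \<noteq> 0"
proof
  assume "invertible_mat A"
  then obtain B where AB: "A * B = 1\<^sub>m n" and BA: "B * A = 1\<^sub>m (dim_row B)"
    using A by (auto simp: invertible_mat_def inverts_mat_def)
  \<comment> \<open>\<open>invertible_mat\<close> does not prescribe the shape of the inverse;
    comparing column counts in both equations forces \<open>B\<close> to be \<open>n\<close> by
    \<open>n\<close>.\<close>
  from arg_cong[OF AB, of dim_col] arg_cong[OF BA, of dim_col] A
  have "B \<in> carrier_mat n n" by auto
  then have "det A * det B = 1" using det_mult[OF A] AB by (metis det_one)
  then show "det A \<noteq> 0" by auto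
next
  assume "det A \<noteq> 0"
  from det_non_zero_imp_unit[OF A this, of "()"]
  obtain B where "B \<in> carrier_mat n n" "A * B = 1\<^sub>m n" "B * A = 1\<^sub>m n"
    by (auto simp: Units_def ring_mat_def)
  then show "invertible_mat A"
    using A by (auto simp: invertible_mat_def inverts_mat_def)
qed

lemma det_2_by_2:
  assumes "A \<in> carrier_mat 2 2"
  shows "det A = A $$ (0, 0) * A $$ (1, 1) - A $$ (0, 1) * A $$ (1, 0)"
proof -
  have "mat_delete A 0 0 \<in> carrier_mat 1 1" "mat_delete A 0 1 \<in> carrier_mat 1 1"
    using assms by (auto simp: mat_delete_def)
  then have "cofactor A 0 0 = A $$ (1, 1)" "cofactor A 0 1 = - A $$ (1, 0)"
    using assms by (auto simp: cofactor_def det_single mat_delete_def)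
  then show ?thesis
    using laplace_expansion_row[OF assms, of 0] by (simp add: numeral_2_eq_2)
qed

text \<open>\<open>pick\<close> enumerates a set increasingly through least elements, so
  \<open>a < b\<close> fixes the order of rows or columns in a submatrix.\<close>

lemma pick_doubleton:
  assumes "a < (b :: nat)"
  shows "pick {a, b} 0 = a" "pick {a, b} (Suc 0) = b"
proof -
  show *: "pick {a, b} 0 = a" using assms by (auto intro!: Least_equality)
  show "pick {a, b} (Suc 0) = b"
    unfolding pick.simps(2) * using assms by (auto intro!: Least_equality)
qed

lemma bit_of_int_neq_0_iff: "(of_int n :: bit) \<noteq> 0 \<longleftrightarrow> odd n"
  by (metis bit_not_zero_iff even_of_int_iff even_zero odd_one)

text \<open>Reduction modulo 2 is a ring homomorphism, so the determinant over \<open>bit\<close> is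
  the parity of the integer minor.\<close>

lemma invertible_submatrix_doubleton:
  assumes "a < b" "b < dim_row M" "c < d" "d < dim_col M"
  shows "invertible_mat (map_mat (of_int :: int \<Rightarrow> bit) (submatrix M {a, b} {c, d}))
     \<longleftrightarrow> odd (M $$ (a, c) * M $$ (b, d) - M $$ (a, d) * M $$ (b, c))"
proof -
  let ?S = "map_mat (of_int :: int \<Rightarrow> bit) (submatrix M {a, b} {c, d})"
  have "{i. i < dim_row M \<and> (i = a \<or> i = b)} = {a, b}"
       "{i. i < dim_col M \<and> (i = c \<or> i = d)} = {c, d}"
    using assms by auto
  then have dims: "dim_row (submatrix M {a, b} {c, d}) = 2" "dim_col (submatrix M {a, b} {c, d}) = 2"
    using assms by (auto simp: submatrix_def)
  have entry: "submatrix M {a, b} {c, d} $$ (i, j) = M $$ (pick {a, b} i, pick {c, d} j)"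
      if "i < 2" "j < 2" for i j
    using dims that by (intro submatrix_index) (auto simp: dim_submatrix)
  have carrier: "?S \<in> carrier_mat 2 2" using dims by auto
  have "?S $$ (0, 0) = of_int (M $$ (a, c))" "?S $$ (0, 1) = of_int (M $$ (a, d))"
    "?S $$ (1, 0) = of_int (M $$ (b, c))" "?S $$ (1, 1) = of_int (M $$ (b, d))"
    using dims by (simp_all add: entry pick_doubleton[OF assms(1)] pick_doubleton[OF assms(3)]
      del: pick.simps)
  then have "det ?S = of_int (M $$ (a, c) * M $$ (b, d) - M $$ (a, d) * M $$ (b, c))"
    unfolding det_2_by_2[OF carrier] by (simp only: of_int_mult of_int_diff)
  then show ?thesis
    unfolding invertible_mat_iff_det[OF carrier] by (simp only: bit_of_int_neq_0_iff)
qed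

text \<open>Meant for the three classes of nonzero columns over a pair of rows. Listing the classes
  in a fixed order selects one orientation of each doubleton, which makes
  \<open>(c, d) \<mapsto> {c, d}\<close> injective.\<close>

lemma card_doubletons_distinct_classes:
  assumes fin: "finite P" "finite Q" "finite R"
    and disj: "P \<inter> Q = {}" "P \<inter> R = {}" "Q \<inter> R = {}"
  shows "card {J. \<exists>c d. J = {c, d} \<and> (c, d) \<in> P \<times> Q \<union> P \<times> R \<union> Q \<times> R}
     = card P * card Q + card P * card R + card Q * card R" (is "card ?L = _")
proof -
  have "?L = (\<lambda>(c, d). {c, d}) ` (P \<times> Q \<union> P \<times> R \<union> Q \<times> R)" by auto
  moreover have "inj_on (\<lambda>(c, d). {c, d}) (P \<times> Q \<union> P \<times> R \<union> Q \<times> R)"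
    using disj by (auto simp: inj_on_def doubleton_eq_iff)
  moreover have "P \<times> Q \<inter> P \<times> R = {}" "(P \<times> Q \<union> P \<times> R) \<inter> Q \<times> R = {}"
    using disj by auto
  then have "card (P \<times> Q \<union> P \<times> R \<union> Q \<times> R) = card P * card Q + card P * card R + card Q * card R"
    using fin by (simp add: card_Un_disjoint card_cartesian_product)
  ultimately show ?thesis by (simp add: card_image)
qed

lemma card_doubleton_less:
  fixes I :: "'a :: linorder set"
  assumes "card I = 2"
  obtains a b where "a < b" "I = {a, b}"
  using assms by (metis card_2_iff insert_commute linorder_neqE)

text \<open>The bound \<open>l \<le> k\<close> is exported as well, because the count is stated with
  truncated subtraction and has to be transferred to the reals.\<close>

lemma card_invertible_submatrices_two_rows:
  assumes sym: "symmetric_bibd X (mset As) v k l" and xs: "distinct xs" "set xs = X"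
    and M: "M = mat (length xs) (length As) (\<lambda>(i, j). if xs ! i \<in> As ! j then 1 else 0)"
    and I: "I \<subseteq> {..<length xs}" "card I = 2"
  shows "l \<le> k"
    and "card {J. J \<subseteq> {..<length As} \<and> card J = 2 \<and>
        invertible_mat (map_mat (of_int :: int \<Rightarrow> bit) (submatrix M I J))} = k\<^sup>2 - l\<^sup>2"
proof -
  obtain a b where ab: "a < b" "I = {a, b}" using card_doubleton_less[OF I(2)] by blast
  have b: "b < length xs" using I ab by auto
  have mem: "xs ! a \<in> X" "xs ! b \<in> X" "xs ! a \<noteq> xs ! b"
    using xs ab b by (auto simp: nth_eq_iff_index_eq)
  \<comment> \<open>Column indices stand in for blocks, since equal blocks still give different
    columns.\<close>
  define B where "B = (\<lambda>i. {j. j < length As \<and> xs ! i \<in> As ! j})"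
  have card_mset: "card {j. j < length As \<and> P (As ! j)} = size {#A \<in># mset As. P A#}" for P
    by (metis length_filter_conv_card mset_filter size_mset)
  have fin: "finite (B a)" "finite (B b)" by (auto simp: B_def)
  have Ba: "card (B a) = k" and Bb: "card (B b) = k"
    using symmetric_bibd_replication[OF sym] mem by (auto simp: B_def card_mset)
  have "B a \<inter> B b = {j. j < length As \<and> xs ! a \<in> As ! j \<and> xs ! b \<in> As ! j}"
    by (auto simp: B_def)
  then have Bab: "card (B a \<inter> B b) = l"
    using sym mem card_mset[of "\<lambda>A. xs ! a \<in> A \<and> xs ! b \<in> A"]
    by (auto simp: symmetric_bibd_def bibd_def)
  show le: "l \<le> k" using card_mono[OF fin(1), of "B a \<inter> B b"] Ba Bab by simp
  \<comment> \<open>The columns that restrict to \<open>(1,1)\<close>, \<open>(1,0)\<close> and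
    \<open>(0,1)\<close> on rows \<open>a\<close> and \<open>b\<close>; all others restrict to
    zero.\<close>
  define P Q R where "P = B a \<inter> B b" and "Q = B a - B b" and "R = B b - B a"
  have cards: "card P = l" "card Q = k - l" "card R = k - l"
    using Ba Bb Bab fin by (auto simp: P_def Q_def R_def card_Diff_subset_Int Int_commute)
  \<comment> \<open>The minor is odd exactly when the two columns lie in different classes among
    \<open>P\<close>, \<open>Q\<close>, \<open>R\<close>. Columns are ordered here by index and not
    by class, hence both orientations.\<close>
  have inv: "invertible_mat (map_mat (of_int :: int \<Rightarrow> bit) (submatrix M I {c, d})) \<longleftrightarrow>
      (c, d) \<in> P \<times> Q \<union> P \<times> R \<union> Q \<times> R \<or> (d, c) \<in> P \<times> Q \<union> P \<times> R \<union> Q \<times> R"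
    if "c < d" "d < length As" for c d
  proof -
    have "invertible_mat (map_mat (of_int :: int \<Rightarrow> bit) (submatrix M {a, b} {c, d})) \<longleftrightarrow>
      odd (M $$ (a, c) * M $$ (b, d) - M $$ (a, d) * M $$ (b, c))"
      using that ab b by (intro invertible_submatrix_doubleton) (auto simp: M)
    then show ?thesis
      using that ab b by (auto simp: M P_def Q_def R_def B_def)
  qed
  have "{J. J \<subseteq> {..<length As} \<and> card J = 2 \<and>
        invertible_mat (map_mat (of_int :: int \<Rightarrow> bit) (submatrix M I J))}
      = {J. \<exists>c d. J = {c, d} \<and> (c, d) \<in> P \<times> Q \<union> P \<times> R \<union> Q \<times> R}" (is "?L = ?R")
  proof (intro equalityI subsetI)
    fix J assume J: "J \<in> ?L"
    then obtain c d where cd: "c < d" "J = {c, d}" using card_doubleton_less by blast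
    with J inv show "J \<in> ?R" by (auto simp: insert_commute) blast+
  next
    fix J assume "J \<in> ?R"
    then obtain c d where cd: "J = {c, d}" "(c, d) \<in> P \<times> Q \<union> P \<times> R \<union> Q \<times> R" by blast
    then have "c \<noteq> d" "c < length As" "d < length As"
      by (auto simp: P_def Q_def R_def B_def)
    with cd inv[of c d] inv[of d c] show "J \<in> ?L"
      by (cases "c < d") (auto simp: insert_commute)
  qed
  moreover have "card ?R = card P * card Q + card P * card R + card Q * card R"
    using fin by (intro card_doubletons_distinct_classes) (auto simp: P_def Q_def R_def)
  moreover have "l * (k - l) + l * (k - l) + (k - l) * (k - l) = k\<^sup>2 - l\<^sup>2"
  proof -
    \<comment> \<open>With \<open>m = k - l\<close> both sides become
      \<open>2 * l * m + m * m\<close>, free of truncated subtraction.\<close>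
    obtain m where "k = l + m" using le le_Suc_ex by blast
    then show ?thesis by (simp add: power2_eq_square algebra_simps)
  qed
  ultimately show "card ?L = k\<^sup>2 - l\<^sup>2" by (simp add: cards)
qed

theorem theorem5p3:
  fixes X :: "'a set" and \<A> :: "'a set multiset" and v k l :: nat and M :: "int mat"
  assumes "symmetric_bibd X \<A> v k l"
    and "is_incidence_matrix M X \<A>"
    and "odd k" and "even l"
  shows "R2 M = ((real k)\<^sup>2 - (real l)\<^sup>2) / real (v choose 2)"
proof -
  obtain xs As where xs: "distinct xs" "set xs = X" and As: "mset As = \<A>"
    and M: "M = mat (length xs) (length As) (\<lambda>(i, j). if xs ! i \<in> As ! j then 1 else 0)"
    using assms(2) by (auto simp: is_incidence_matrix_def)
  have v: "2 \<le> v" "length xs = v" "length As = v"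
    using assms(1) xs As distinct_card[OF xs(1)]
    by (auto simp: symmetric_bibd_def bibd_def simp flip: size_mset)
  have sym: "symmetric_bibd X (mset As) v k l" using assms(1) As by simp
  note row = card_invertible_submatrices_two_rows[OF sym xs M]
  \<comment> \<open>The submatrices are fibred over their row pairs; every fibre
    \<open>\<J> I\<close> with \<open>I \<in> \<I>\<close> has the same size.\<close>
  define \<I> where "\<I> = {I. I \<subseteq> {..<v} \<and> card I = 2}"
  have card\<I>: "card \<I> = v choose 2"
    using n_subsets[of "{..<v}" 2] by (simp add: \<I>_def)
  define \<J> where "\<J> = (\<lambda>I. {J. J \<subseteq> {..<v} \<and> card J = 2 \<and>
    invertible_mat (map_mat (of_int :: int \<Rightarrow> bit) (submatrix M I J))})"
  have "dim_row M = v" "dim_col M = v" using M v by auto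
  then have "{(I, J). I \<subseteq> {..<dim_row M} \<and> J \<subseteq> {..<dim_col M} \<and> card I = 2 \<and> card J = 2 \<and>
     invertible_mat (map_mat (of_int :: int \<Rightarrow> bit) (submatrix M I J))} = Sigma \<I> \<J>"
    by (auto simp: \<I>_def \<J>_def)
  moreover have "finite \<I>" "finite (\<J> I)" for I
    by (auto simp: \<I>_def \<J>_def intro: finite_subset[of _ "Pow {..<v}"])
  ultimately have "N2 M = (\<Sum>I\<in>\<I>. card (\<J> I))"
    by (simp add: N2_def)
  also have "\<dots> = (\<Sum>I\<in>\<I>. k\<^sup>2 - l\<^sup>2)"
    using row(2) v by (intro sum.cong) (auto simp: \<I>_def \<J>_def)
  finally have N2: "N2 M = (v choose 2) * (k\<^sup>2 - l\<^sup>2)" by (simp add: card\<I>)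
  \<comment> \<open>Any row pair would do to extract \<open>l \<le> k\<close>; one exists because
    \<open>v \<ge> 2\<close>.\<close>
  have "{0, 1} \<in> \<I>" using v by (auto simp: \<I>_def)
  then have "l \<le> k" using row(1)[of "{0, 1}"] v by (auto simp: \<I>_def)
  then have "real (N2 M) = real (v choose 2) * ((real k)\<^sup>2 - (real l)\<^sup>2)"
    by (simp add: N2 of_nat_diff power_mono)
  \<comment> \<open>Allows one factor of the squared binomial in \<open>R2\<close> to be
    cancelled.\<close>
  moreover have "v choose 2 \<noteq> 0" using v by simp
  ultimately show ?thesis
    using \<open>dim_row M = v\<close> by (simp add: R2_def power2_eq_square)
qed

end
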